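(* Let $\mu>0$, $d>0$ and $t\in\mathbb{R}$. The solution to $$\sup_{\mathbb{P}\in\mathcal{P}(\mu,d)}\mathbb{E}[\max\{X-t,0\}]$$ can be described as follows. (i) If $\mu-t>0$, the optimal (limiting) distribution is obtained by taking two-point distributions in $\mathcal{P}(\mu,d)$ with support points $v_1\to-\infty$, $v_2\to\mu+d/2$, with optimal objective $\mu-t+d/2$. (ii) If $\mu-t<0$, the optimal (limiting) distribution is obtained by taking two-point distributions in $\mathcal{P}(\mu,d)$ with support points $v_1\to\mu-d/2$, $v_2\to\infty$, with optimal objective $d/2$. (iii) If $\mu-t=0$, any distribution in $\mathcal{P}(\mu,d)$ yields the same objective $d/2$.
   Context: $\mathcal{P}(\mu,d)$ is the set of all probability distributions $\mathbb{P}$ on $\mathbb{R}$ such that, for $X\sim\mathbb{P}$, $\mathbb{E}_{\mathbb{P}}(X)=\mu$ and $\mathbb{E}_{\mathbb{P}}(|X-\mu|)=d$. A two-point distribution is a distribution supported on two points $v_1<\mu<v_2$ with probability masses $w_1,w_2$. *)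

theory Defs
  imports "HOL-Probability.Probability"
begin

text \<open>A distribution on \<open>\<real>\<close> is a probability measure on the Borel sets, so \<open>X\<close> is the
  identity map. Integrability is required explicitly because the Bochner integral of a
  non-integrable function is \<open>0\<close>; it also makes \<^term>\<open>\<lambda>x::real. max (x - t) 0\<close> integrable, so
  \<open>expected_excess\<close> below is a genuine expectation on this set.\<close>

definition mean_mad_set :: "real \<Rightarrow> real \<Rightarrow> real measure set" where
  "mean_mad_set \<mu> d = {P. real_distribution P \<and> integrable P (\<lambda>x. x) \<and>
     (LINT x|P. x) = \<mu> \<and> (LINT x|P. \<bar>x - \<mu>\<bar>) = d}"

definition expected_excess :: "real \<Rightarrow> real measure \<Rightarrow> real" where
  "expected_excess t P = (LINT x|P. max (x - t) 0)"

definition two_point_distribution ::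
  "real \<Rightarrow> real \<Rightarrow> real \<Rightarrow> real \<Rightarrow> real \<Rightarrow> real measure \<Rightarrow> bool" where
  "two_point_distribution \<mu> v1 v2 w1 w2 P \<longleftrightarrow>
     real_distribution P \<and> v1 < \<mu> \<and> \<mu> < v2 \<and> 0 < w1 \<and> 0 < w2 \<and> w1 + w2 = 1 \<and>
     measure P {v1} = w1 \<and> measure P {v2} = w2"

text \<open>The filters \<open>F1\<close> and \<open>F2\<close> prescribe the limits of the lower and upper support points
  (\<open>at_bot\<close>, \<open>at_top\<close> or a neighbourhood filter).\<close>

definition two_point_sequence ::
  "real \<Rightarrow> real \<Rightarrow> real filter \<Rightarrow> real filter \<Rightarrow> (nat \<Rightarrow> real measure) \<Rightarrow> bool" where
  "two_point_sequence \<mu> d F1 F2 P \<longleftrightarrow>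
     (\<exists>v1 v2 w1 w2.
        (\<forall>n. P n \<in> mean_mad_set \<mu> d \<and>
             two_point_distribution \<mu> (v1 n) (v2 n) (w1 n) (w2 n) (P n)) \<and>
        filterlim v1 F1 sequentially \<and> filterlim v2 F2 sequentially)"

end

theory Submission
  imports Defs "HOL-Real_Asymp.Real_Asymp"
begin

text \<open>
  Write \<open>max (x - t) 0 = (x - t + \<bar>x - t\<bar>) / 2\<close>. The linear part has expectation
  \<open>\<mu> - t\<close> for every admissible distribution, and \<open>\<bar>x - t\<bar> \<le> \<bar>x - \<mu>\<bar> + \<bar>\<mu> - t\<bar>\<close>
  bounds the other part, so the objective is at most \<open>max (\<mu> - t) 0 + d / 2\<close>
  (\<open>expected_excess_upper_bound\<close>). In each of the three cases this is the claimed value.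

  For \<open>t = \<mu>\<close> the triangle inequality is an equality, so all distributions agree. Otherwise
  it is strict exactly on the points lying strictly on the side of \<open>\<mu>\<close> that contains \<open>t\<close>
  and sharp elsewhere, and its defect is at most \<open>2 * \<bar>\<mu> - t\<bar>\<close>. The bound is therefore
  approached when the mass on that side of \<open>\<mu>\<close> tends to \<open>0\<close>. A two-point distribution
  with mean \<open>\<mu>\<close> and mean absolute deviation \<open>d\<close> satisfies
  \<open>w1 * (\<mu> - v1) = d / 2 = w2 * (v2 - \<mu>)\<close> (\<open>two_point_balance\<close>): each side carries half
  of the deviation, so sending one support point to infinity drives its mass to \<open>0\<close>, and the
  other support point to distance \<open>d / 2\<close> from \<open>\<mu>\<close>.
\<close>

section \<open>The upper bound\<close>

lemma expected_excess_eq: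
  assumes P: "P \<in> mean_mad_set \<mu> d"
  shows "expected_excess t P = (\<mu> - t + (LINT x|P. \<bar>x - t\<bar>)) / 2"
proof -
  interpret real_distribution P
    using P by (simp add: mean_mad_set_def)
  have int: "integrable P (\<lambda>x. x)" and mean: "(LINT x|P. x) = \<mu>"
    using P by (auto simp: mean_mad_set_def)
  have "expected_excess t P = (LINT x|P. ((x - t) + \<bar>x - t\<bar>) / 2)"
    unfolding expected_excess_def by (intro Bochner_Integration.integral_cong) (auto simp: max_def abs_if)
  also have "\<dots> = ((LINT x|P. x) - t + (LINT x|P. \<bar>x - t\<bar>)) / 2"
    using int prob_space by simp
  finally show ?thesis
    by (simp add: mean)
qed

text \<open>For \<open>t = \<mu>\<close> the absolute moment in the preceding formula is the prescribed one.\<close>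

lemma expected_excess_at_mean:
  assumes "P \<in> mean_mad_set \<mu> d"
  shows "expected_excess \<mu> P = d / 2"
  using expected_excess_eq[OF assms, of \<mu>] assms by (simp add: mean_mad_set_def)

lemma expected_excess_upper_bound:
  assumes P: "P \<in> mean_mad_set \<mu> d"
  shows "expected_excess t P \<le> max (\<mu> - t) 0 + d / 2"
proof -
  interpret real_distribution P
    using P by (simp add: mean_mad_set_def)
  have int: "integrable P (\<lambda>x. x)" and mad: "(LINT x|P. \<bar>x - \<mu>\<bar>) = d"
    using P by (auto simp: mean_mad_set_def)
  have "(LINT x|P. \<bar>x - t\<bar>) \<le> (LINT x|P. \<bar>x - \<mu>\<bar> + \<bar>\<mu> - t\<bar>)"
    using int by (intro integral_mono) auto
  also have "\<dots> = d + \<bar>\<mu> - t\<bar>"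
    using int mad prob_space by simp
  finally show ?thesis
    unfolding expected_excess_eq[OF P] by (cases "\<mu> \<le> t") simp_all
qed

section \<open>Two-point distributions\<close>

lemma integral_two_point_distribution:
  assumes P: "two_point_distribution \<mu> v1 v2 w1 w2 P"
    and f: "f \<in> borel_measurable borel"
  shows "(LINT x|P. f x) = w1 * f v1 + w2 * f v2"
proof -
  interpret real_distribution P
    using P by (simp add: two_point_distribution_def)
  have neq: "v1 \<noteq> v2" and w: "prob {v1} = w1" "prob {v2} = w2" "w1 + w2 = 1"
    using P by (auto simp: two_point_distribution_def)
  have "prob ({v1} \<union> {v2}) = 1"
    using neq w by (subst finite_measure_Union) auto
  then have "AE x in P. x \<in> {v1} \<union> {v2}"
    by (rule AE_prob_1)
  then have "(LINT x|P. f x) = (LINT x|P. f v1 * indicator {v1} x + f v2 * indicator {v2} x)"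
    using neq f by (intro integral_cong_AE) auto
  also have "\<dots> = w1 * f v1 + w2 * f v2"
    using w by (simp add: less_top[symmetric] emeasure_eq_measure)
  finally show ?thesis .
qed

lemma expected_excess_two_point:
  assumes "two_point_distribution \<mu> v1 v2 w1 w2 P"
  shows "expected_excess t P = w1 * max (v1 - t) 0 + w2 * max (v2 - t) 0"
  unfolding expected_excess_def by (rule integral_two_point_distribution[OF assms]) auto

text \<open>The mean balances the deviations on the two sides of \<open>\<mu>\<close> against each other, and
  together they make up \<open>d\<close>.\<close>

lemma two_point_balance:
  assumes P: "P \<in> mean_mad_set \<mu> d" and tp: "two_point_distribution \<mu> v1 v2 w1 w2 P"
  shows "w1 * (\<mu> - v1) = d / 2" and "w2 * (v2 - \<mu>) = d / 2"
proof -
  have v: "v1 < \<mu>" "\<mu> < v2" and w: "w1 + w2 = 1"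
    using tp by (auto simp: two_point_distribution_def)
  have "w1 * v1 + w2 * v2 = \<mu>"
    using P integral_two_point_distribution[OF tp, of "\<lambda>x. x"] by (simp add: mean_mad_set_def)
  then have "w1 * v1 + w2 * v2 = (w1 + w2) * \<mu>"
    using w by simp
  moreover have "w1 * (\<mu> - v1) + w2 * (v2 - \<mu>) = d"
    using P v integral_two_point_distribution[OF tp, of "\<lambda>x. \<bar>x - \<mu>\<bar>"]
    by (simp add: mean_mad_set_def)
  moreover have "w2 * (v2 - \<mu>) - w1 * (\<mu> - v1) = w1 * v1 + w2 * v2 - (w1 + w2) * \<mu>"
    by (simp add: algebra_simps)
  ultimately show "w1 * (\<mu> - v1) = d / 2" "w2 * (v2 - \<mu>) = d / 2"
    by linarith+
qed

text \<open>Solving the balance equations for the support points leaves the lower mass \<open>p\<close> as a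
  free parameter; letting \<open>p\<close> tend to \<open>0\<close> or \<open>1\<close> produces the two limiting families.\<close>

lemma ex_two_point_distribution:
  assumes d: "d > 0" and p: "0 < p" "p < 1"
  shows "\<exists>P \<in> mean_mad_set \<mu> d.
    two_point_distribution \<mu> (\<mu> - d / (2 * p)) (\<mu> + d / (2 * (1 - p))) p (1 - p) P"
proof -
  define v1 v2 where "v1 = \<mu> - d / (2 * p)" and "v2 = \<mu> + d / (2 * (1 - p))"
  have v: "v1 < \<mu>" "\<mu> < v2"
    using d p by (auto simp: v1_def v2_def)
  have bal: "p * (\<mu> - v1) = d / 2" "(1 - p) * (v2 - \<mu>) = d / 2"
    using p by (simp_all add: v1_def v2_def divide_simps)
  have "p * v1 + (1 - p) * v2 = \<mu> - p * (\<mu> - v1) + (1 - p) * (v2 - \<mu>)"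
    by (simp add: algebra_simps)
  then have mean: "p * v1 + (1 - p) * v2 = \<mu>"
    unfolding bal by simp
  have abs: "\<bar>v1 - \<mu>\<bar> = \<mu> - v1" "\<bar>v2 - \<mu>\<bar> = v2 - \<mu>"
    using v by simp_all
  have mad: "p * \<bar>v1 - \<mu>\<bar> + (1 - p) * \<bar>v2 - \<mu>\<bar> = d"
    unfolding abs bal by simp
  define g where "g = (\<lambda>b. if b then v1 else v2)"
  define P where "P = distr (measure_pmf (bernoulli_pmf p)) borel g"
  have rd: "real_distribution P"
    unfolding P_def by (intro prob_space.real_distribution_distr prob_space_measure_pmf) simp
  have int: "integrable P f" if "f \<in> borel_measurable borel" for f :: "real \<Rightarrow> real"
    unfolding P_def using that by (subst integrable_distr_eq) (simp_all add: integrable_measure_pmf_finite)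
  have lint: "(LINT x|P. f x) = p * f v1 + (1 - p) * f v2"
    if "f \<in> borel_measurable borel" for f :: "real \<Rightarrow> real"
    unfolding P_def using that p by (subst integral_distr) (simp_all add: g_def)
  have "measure P {v} = measure_pmf.prob (bernoulli_pmf p) (g -` {v})" for v
    unfolding P_def by (subst measure_distr) auto
  moreover have "g -` {v1} = {True}" "g -` {v2} = {False}"
    using v by (auto simp: g_def split: if_split_asm)
  ultimately have mass: "measure P {v1} = p" "measure P {v2} = 1 - p"
    using p by (simp_all add: measure_pmf_single)
  have "integrable P (\<lambda>x. x)"
    by (rule int) simp
  moreover have "(LINT x|P. x) = \<mu>"
    using lint[of "\<lambda>x. x"] unfolding mean by simp
  moreover have "(LINT x|P. \<bar>x - \<mu>\<bar>) = d"
    using lint[of "\<lambda>x. \<bar>x - \<mu>\<bar>"] unfolding mad by simp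
  ultimately have "P \<in> mean_mad_set \<mu> d"
    using rd unfolding mean_mad_set_def by blast
  moreover have "two_point_distribution \<mu> v1 v2 p (1 - p) P"
    unfolding two_point_distribution_def using rd v p mass by simp
  ultimately show ?thesis
    unfolding v1_def v2_def by blast
qed

section \<open>Limiting two-point sequences\<close>

lemma ex_two_point_sequence:
  assumes d: "d > 0" and p: "\<And>n. 0 < p n" "\<And>n. p n < 1"
    and "filterlim (\<lambda>n. \<mu> - d / (2 * p n)) F1 sequentially"
    and "filterlim (\<lambda>n. \<mu> + d / (2 * (1 - p n))) F2 sequentially"
  shows "\<exists>P. two_point_sequence \<mu> d F1 F2 P"
proof -
  define tp where "tp n P \<longleftrightarrow> P \<in> mean_mad_set \<mu> d \<and> two_point_distribution \<mu>
      (\<mu> - d / (2 * p n)) (\<mu> + d / (2 * (1 - p n))) (p n) (1 - p n) P" for n P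
  have "\<exists>P. tp n P" for n
    using ex_two_point_distribution[OF d p] unfolding tp_def by blast
  then obtain P where "\<And>n. tp n (P n)"
    by metis
  with assms(4,5) show ?thesis
    unfolding two_point_sequence_def tp_def
    by (intro exI[of _ P] exI[of _ "\<lambda>n. \<mu> - d / (2 * p n)"]
        exI[of _ "\<lambda>n. \<mu> + d / (2 * (1 - p n))"] exI[of _ p] exI[of _ "\<lambda>n. 1 - p n"]) simp
qed

lemma ex_two_point_sequence_lower:
  assumes "d > 0"
  shows "\<exists>P. two_point_sequence \<mu> d at_bot (nhds (\<mu> + d / 2)) P"
proof (rule ex_two_point_sequence[where p = "\<lambda>n. 1 / real (n + 2)"])
  show "filterlim (\<lambda>n. \<mu> - d / (2 * (1 / real (n + 2)))) at_bot sequentially"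
    using assms by real_asymp
  show "(\<lambda>n. \<mu> + d / (2 * (1 - 1 / real (n + 2)))) \<longlonglongrightarrow> \<mu> + d / 2"
    using assms by real_asymp
qed (use assms in auto)

lemma ex_two_point_sequence_upper:
  assumes "d > 0"
  shows "\<exists>P. two_point_sequence \<mu> d (nhds (\<mu> - d / 2)) at_top P"
proof (rule ex_two_point_sequence[where p = "\<lambda>n. 1 - 1 / real (n + 2)"])
  show "(\<lambda>n. \<mu> - d / (2 * (1 - 1 / real (n + 2)))) \<longlonglongrightarrow> \<mu> - d / 2"
    using assms by real_asymp
  show "filterlim (\<lambda>n. \<mu> + d / (2 * (1 - (1 - 1 / real (n + 2))))) at_top sequentially"
    using assms by real_asymp
qed (use assms in auto)

text \<open>Once \<open>v1\<close> lies below \<open>t\<close>, only the upper point contributes, and its mass tends to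
  \<open>1\<close> because \<open>w1 = (d / 2) / (\<mu> - v1)\<close> vanishes.\<close>

lemma expected_excess_tendsto_lower:
  assumes t: "t < \<mu>" and d: "d > 0"
    and P: "two_point_sequence \<mu> d at_bot (nhds (\<mu> + d / 2)) P"
  shows "(\<lambda>n. expected_excess t (P n)) \<longlonglongrightarrow> \<mu> - t + d / 2"
proof -
  obtain v1 v2 w1 w2 where mem: "\<And>n. P n \<in> mean_mad_set \<mu> d"
    and tp: "\<And>n. two_point_distribution \<mu> (v1 n) (v2 n) (w1 n) (w2 n) (P n)"
    and v1: "filterlim v1 at_bot sequentially" and v2: "v2 \<longlonglongrightarrow> \<mu> + d / 2"
    using P unfolding two_point_sequence_def by blast
  have v: "v1 n < \<mu>" "\<mu> < v2 n" and w2: "w2 n = 1 - w1 n" for n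
    using tp[of n] by (auto simp: two_point_distribution_def)
  have w1: "w1 n = d / 2 / (\<mu> - v1 n)" for n
    using two_point_balance(1)[OF mem tp, of n] v(1)[of n] by (simp add: field_simps)
  have "filterlim (\<lambda>n. \<mu> - v1 n) at_top sequentially"
    using filterlim_tendsto_add_at_top[OF tendsto_const[of \<mu>],
        OF filterlim_compose[OF filterlim_uminus_at_top_at_bot v1]] by simp
  then have "w1 \<longlonglongrightarrow> 0"
    unfolding w1[abs_def] by (intro tendsto_divide_0[OF tendsto_const] filterlim_at_top_imp_at_infinity)
  then have "(\<lambda>n. (1 - w1 n) * (v2 n - t)) \<longlonglongrightarrow> (1 - 0) * (\<mu> + d / 2 - t)"
    using v2 by (intro tendsto_intros)
  moreover have "\<forall>\<^sub>F n in sequentially. v1 n \<le> t"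
    using v1 by (simp add: filterlim_at_bot)
  then have "\<forall>\<^sub>F n in sequentially. (1 - w1 n) * (v2 n - t) = expected_excess t (P n)"
  proof eventually_elim
    case (elim n)
    then show ?case
      using t v(2)[of n] by (simp add: expected_excess_two_point[OF tp] w2)
  qed
  ultimately have "(\<lambda>n. expected_excess t (P n)) \<longlonglongrightarrow> (1 - 0) * (\<mu> + d / 2 - t)"
    by (rule Lim_transform_eventually)
  then show ?thesis
    by (simp add: algebra_simps)
qed

text \<open>The lower point always lies below \<open>\<mu> < t\<close>. Above \<open>t\<close>, the upper point contributes
  \<open>w2 * (v2 - \<mu>) = d / 2\<close> up to the correction \<open>w2 * (\<mu> - t)\<close>, which vanishes with its
  mass.\<close>

lemma expected_excess_tendsto_upper:
  assumes t: "\<mu> < t"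
    and P: "two_point_sequence \<mu> d (nhds (\<mu> - d / 2)) at_top P"
  shows "(\<lambda>n. expected_excess t (P n)) \<longlonglongrightarrow> d / 2"
proof -
  obtain v1 v2 w1 w2 where mem: "\<And>n. P n \<in> mean_mad_set \<mu> d"
    and tp: "\<And>n. two_point_distribution \<mu> (v1 n) (v2 n) (w1 n) (w2 n) (P n)"
    and v2: "filterlim v2 at_top sequentially"
    using P unfolding two_point_sequence_def by blast
  have v: "v1 n < \<mu>" "\<mu> < v2 n" for n
    using tp[of n] by (auto simp: two_point_distribution_def)
  have bal: "w2 n * (v2 n - \<mu>) = d / 2" for n
    by (rule two_point_balance(2)[OF mem tp])
  have w2: "w2 n = d / 2 / (v2 n - \<mu>)" for n
    using bal[of n] v(2)[of n] by (simp add: field_simps)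
  have "filterlim (\<lambda>n. v2 n - \<mu>) at_top sequentially"
    using filterlim_tendsto_add_at_top[OF tendsto_const[of "- \<mu>"] v2] by simp
  then have "w2 \<longlonglongrightarrow> 0"
    unfolding w2[abs_def] by (intro tendsto_divide_0[OF tendsto_const] filterlim_at_top_imp_at_infinity)
  then have "(\<lambda>n. d / 2 + w2 n * (\<mu> - t)) \<longlonglongrightarrow> d / 2 + 0 * (\<mu> - t)"
    by (intro tendsto_intros)
  moreover have "\<forall>\<^sub>F n in sequentially. t \<le> v2 n"
    using v2 by (simp add: filterlim_at_top)
  then have "\<forall>\<^sub>F n in sequentially. d / 2 + w2 n * (\<mu> - t) = expected_excess t (P n)"
  proof eventually_elim
    case (elim n)
    then show ?case
      using t v(1)[of n] bal[of n]
      by (simp add: expected_excess_two_point[OF tp] max_absorb1 max_absorb2 right_diff_distrib)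
  qed
  ultimately have "(\<lambda>n. expected_excess t (P n)) \<longlonglongrightarrow> d / 2 + 0 * (\<mu> - t)"
    by (rule Lim_transform_eventually)
  then show ?thesis
    by simp
qed

section \<open>The optimal value\<close>

lemma SUP_expected_excess_eqI:
  assumes seq: "two_point_sequence \<mu> d F1 F2 P"
    and lim: "(\<lambda>n. expected_excess t (P n)) \<longlonglongrightarrow> max (\<mu> - t) 0 + d / 2"
  shows "(SUP P\<in>mean_mad_set \<mu> d. ereal (expected_excess t P)) =
    ereal (max (\<mu> - t) 0 + d / 2)"
proof (rule antisym)
  show "(SUP P\<in>mean_mad_set \<mu> d. ereal (expected_excess t P)) \<le> ereal (max (\<mu> - t) 0 + d / 2)"
    by (intro SUP_least) (simp add: expected_excess_upper_bound)
  have "P n \<in> mean_mad_set \<mu> d" for n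
    using seq by (auto simp: two_point_sequence_def)
  then have "ereal (expected_excess t (P n)) \<le>
      (SUP P\<in>mean_mad_set \<mu> d. ereal (expected_excess t P))" for n
    by (intro SUP_upper)
  then have "\<exists>N. \<forall>n\<ge>N. ereal (expected_excess t (P n)) \<le>
      (SUP P\<in>mean_mad_set \<mu> d. ereal (expected_excess t P))"
    by simp
  moreover have "(\<lambda>n. ereal (expected_excess t (P n))) \<longlonglongrightarrow> ereal (max (\<mu> - t) 0 + d / 2)"
    using lim by (rule tendsto_ereal)
  ultimately show "ereal (max (\<mu> - t) 0 + d / 2) \<le>
      (SUP P\<in>mean_mad_set \<mu> d. ereal (expected_excess t P))"
    by (intro LIMSEQ_le_const2)
qed

theorem theorem3p5:
  fixes \<mu> d t :: real
  assumes "\<mu> > 0" and "d > 0"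
  shows
    "(\<mu> - t > 0 \<longrightarrow>
        (SUP P\<in>mean_mad_set \<mu> d. ereal (expected_excess t P)) = ereal (\<mu> - t + d / 2) \<and>
        (\<exists>P. two_point_sequence \<mu> d at_bot (nhds (\<mu> + d / 2)) P) \<and>
        (\<forall>P. two_point_sequence \<mu> d at_bot (nhds (\<mu> + d / 2)) P \<longrightarrow>
             (\<lambda>n. expected_excess t (P n)) \<longlonglongrightarrow> \<mu> - t + d / 2)) \<and>
     (\<mu> - t < 0 \<longrightarrow>
        (SUP P\<in>mean_mad_set \<mu> d. ereal (expected_excess t P)) = ereal (d / 2) \<and>
        (\<exists>P. two_point_sequence \<mu> d (nhds (\<mu> - d / 2)) at_top P) \<and>
        (\<forall>P. two_point_sequence \<mu> d (nhds (\<mu> - d / 2)) at_top P \<longrightarrow>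
             (\<lambda>n. expected_excess t (P n)) \<longlonglongrightarrow> d / 2)) \<and>
     (\<mu> - t = 0 \<longrightarrow>
        (SUP P\<in>mean_mad_set \<mu> d. ereal (expected_excess t P)) = ereal (d / 2) \<and>
        (\<forall>P\<in>mean_mad_set \<mu> d. expected_excess t P = d / 2))"
proof (intro conjI impI allI ballI)
  note lower = ex_two_point_sequence_lower[OF \<open>d > 0\<close>, of \<mu>]
    and upper = ex_two_point_sequence_upper[OF \<open>d > 0\<close>, of \<mu>]
  {
    assume "\<mu> - t > 0"
    then have t: "t < \<mu>" by simp
    show "\<exists>P. two_point_sequence \<mu> d at_bot (nhds (\<mu> + d / 2)) P"
      by (rule lower)
    show lim: "(\<lambda>n. expected_excess t (P n)) \<longlonglongrightarrow> \<mu> - t + d / 2"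
      if "two_point_sequence \<mu> d at_bot (nhds (\<mu> + d / 2)) P" for P
      using t \<open>d > 0\<close> that by (rule expected_excess_tendsto_lower)
    show "(SUP P\<in>mean_mad_set \<mu> d. ereal (expected_excess t P)) = ereal (\<mu> - t + d / 2)"
    proof -
      obtain P where P: "two_point_sequence \<mu> d at_bot (nhds (\<mu> + d / 2)) P"
        using lower by blast
      from SUP_expected_excess_eqI[OF P, of t] lim[OF P] t show ?thesis
        by (simp add: max_absorb1)
    qed
  next
    assume "\<mu> - t < 0"
    then have t: "\<mu> < t" by simp
    show "\<exists>P. two_point_sequence \<mu> d (nhds (\<mu> - d / 2)) at_top P"
      by (rule upper)
    show lim: "(\<lambda>n. expected_excess t (P n)) \<longlonglongrightarrow> d / 2"
      if "two_point_sequence \<mu> d (nhds (\<mu> - d / 2)) at_top P" for P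
      using t that by (rule expected_excess_tendsto_upper)
    show "(SUP P\<in>mean_mad_set \<mu> d. ereal (expected_excess t P)) = ereal (d / 2)"
    proof -
      obtain P where P: "two_point_sequence \<mu> d (nhds (\<mu> - d / 2)) at_top P"
        using upper by blast
      from SUP_expected_excess_eqI[OF P, of t] lim[OF P] t show ?thesis
        by (simp add: max_absorb2)
    qed
  next
    assume "\<mu> - t = 0"
    then have t: "t = \<mu>" by simp
    show const: "expected_excess t P = d / 2" if "P \<in> mean_mad_set \<mu> d" for P
      using expected_excess_at_mean[OF that] t by simp
    \<comment> \<open>A supremum over the empty set would be \<open>-\<infinity>\<close>.\<close>
    have "mean_mad_set \<mu> d \<noteq> {}"
      using lower by (auto simp: two_point_sequence_def)
    then show "(SUP P\<in>mean_mad_set \<mu> d. ereal (expected_excess t P)) = ereal (d / 2)"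
      by (simp add: const)
  }
qed

end
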